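(* Let $x$ and $y$ be indeterminates and let $F_n(x,y)$, $n\ge 0$, be the Savage-Viswanathan polynomials. Then, as formal power series in $z$, the ordinary generating function $\sum_{n\ge 0}F_n(x,y)z^n$ equals the continued fraction $$\cfrac{1}{1-\cfrac{yz}{1-\cfrac{xz}{1-\cfrac{(y+1)z}{1-\cfrac{2xz}{1-\cfrac{(y+2)z}{1-\cfrac{3xz}{1-\cfrac{(y+3)z}{1-\cdots}}}}}}}}$$ (the successive partial numerators being $c_1z,c_2z,\ldots$ with $c_{2i-1}=y+i-1$ and $c_{2i}=ix$ for $i\ge 1$), and equivalently equals $$\cfrac{1}{1-yz-\cfrac{xyz^2}{1-(x+y+1)z-\cfrac{2x(y+1)z^2}{1-(2x+y+2)z-\cfrac{3x(y+2)z^2}{1-(3x+y+3)z-\cdots}}}}$$ (that is, $1/(1-\alpha_0z-\beta_1z^2/(1-\alpha_1z-\beta_2z^2/(1-\cdots)))$ with $\alpha_i=ix+y+i$ for $i\ge0$ and $\beta_i=ix(y+i-1)$ for $i\ge 1$).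
   Context: The Savage-Viswanathan polynomials $F_n(x,y)$ are defined by the exponential generating function $\sum_{n\ge 0}F_n(x,y)\frac{z^n}{n!}=\left(\frac{1-x}{e^{z(x-1)}-x}\right)^y$ (a formal power series in $z$; the base has constant term $1$, and $u^y=\exp(y\ln u)$). They are polynomials in $x,y$. An infinite continued fraction denotes the limit, in the $z$-adic (coefficientwise) topology on formal power series, of its finite truncations. *)

theory Defs
  imports Complex_Main "HOL-Computational_Algebra.Computational_Algebra"
begin

instance fract :: ("{idom, ring_char_0}") field_char_0
proof
  have "(of_nat n :: 'a fract) = to_fract (of_nat n)" for n
    by (induction n) simp_all
  then show "inj (of_nat :: nat \<Rightarrow> 'a fract)"
    by (intro injI) simp
qed

text \<open>
  Formal power series in z have coefficients in the field of fractions of \<open>\<rat>[x][y]\<close>;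
  the inner polynomial variable is x, the outer one is y. This field is needed because
  the base of the power in the generating function is a quotient of series with
  constant coefficient 1 - x.
\<close>

type_synonym ratfun = "rat poly poly fract"

definition var_x :: ratfun where
  "var_x = to_fract [:[:0, 1:]:]"

definition var_y :: ratfun where
  "var_y = to_fract [:0, 1:]"

text \<open>
  \<open>u\<^sup>a = exp (a ln u)\<close>, meaningful for series u with constant coefficient 1. Here
  \<open>fps_ln 1\<close> is the series of \<open>ln (1 + z)\<close> and \<open>fps_exp a\<close> that of \<open>exp (a z)\<close>.
\<close>

definition fps_powr :: "'a::field_char_0 fps \<Rightarrow> 'a \<Rightarrow> 'a fps" where
  "fps_powr u a = fps_exp a oo (fps_ln 1 oo (u - 1))"

definition sv_egf :: "'a::field_char_0 \<Rightarrow> 'a \<Rightarrow> 'a fps" where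
  "sv_egf x y = fps_powr (fps_const (1 - x) / (fps_exp (x - 1) - fps_const x)) y"

text \<open>The Savage-Viswanathan polynomials; see \<open>to_fract_sv_poly\<close> for existence.\<close>

definition sv_poly :: "nat \<Rightarrow> rat poly poly" where
  "sv_poly n = (THE p. to_fract p = fact n * fps_nth (sv_egf var_x var_y) n)"

text \<open>
  The n-th truncation of \<open>a\<^sub>0 / (b\<^sub>0 - a\<^sub>1 / (b\<^sub>1 - a\<^sub>2 / (b\<^sub>2 - \<dots>)))\<close>, that is
  \<open>a\<^sub>0 / (b\<^sub>0 - a\<^sub>1 / (b\<^sub>1 - \<dots> - a\<^bsub>n-1\<^esub> / b\<^bsub>n-1\<^esub>))\<close>.
\<close>

primrec cfrac_trunc ::
  "(nat \<Rightarrow> 'a::field fps) \<Rightarrow> (nat \<Rightarrow> 'a fps) \<Rightarrow> nat \<Rightarrow> 'a fps" where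
  "cfrac_trunc a b 0 = 0"
| "cfrac_trunc a b (Suc n) =
     a 0 / (b 0 - cfrac_trunc (\<lambda>i. a (Suc i)) (\<lambda>i. b (Suc i)) n)"

text \<open>
  The library's metric on formal power series induces the topology of coefficientwise
  stabilization, i.e. the z-adic one.
\<close>

definition has_cfrac ::
  "'a::field fps \<Rightarrow> (nat \<Rightarrow> 'a fps) \<Rightarrow> (nat \<Rightarrow> 'a fps) \<Rightarrow> bool" where
  "has_cfrac f a b \<longleftrightarrow> (\<lambda>n. cfrac_trunc a b n) \<longlonglongrightarrow> f"

text \<open>The generating function has polynomial coefficients after scaling by \<open>n!\<close>.\<close>

definition egf_upto :: "nat \<Rightarrow> 'a::{idom, ring_char_0} fract fps \<Rightarrow> bool" where
  "egf_upto n f \<longleftrightarrow> (\<forall>i\<le>n. fact i * fps_nth f i \<in> range to_fract)"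

lemma range_to_fract_add:
  "a \<in> range to_fract \<Longrightarrow> b \<in> range to_fract \<Longrightarrow> a + b \<in> range to_fract"
  by (metis (no_types, lifting) image_iff rangeI to_fract_add)

lemma range_to_fract_mult:
  "a \<in> range to_fract \<Longrightarrow> b \<in> range to_fract \<Longrightarrow> a * b \<in> range to_fract"
  by (metis (no_types, lifting) image_iff rangeI to_fract_mult)

lemma range_to_fract_of_nat: "of_nat n \<in> range to_fract"
proof (induction n)
  case 0
  then show ?case by (metis of_nat_0 rangeI to_fract_0)
next
  case (Suc n)
  then show ?case
    by (metis of_nat_Suc rangeI range_to_fract_add to_fract_1)
qed

lemma range_to_fract_sum:
  "(\<And>i. i \<in> A \<Longrightarrow> f i \<in> range to_fract) \<Longrightarrow> sum f A \<in> range to_fract"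
proof (induction A rule: infinite_finite_induct)
  case (insert a A)
  then show ?case by (simp add: range_to_fract_add)
qed (metis rangeI sum.infinite to_fract_0, metis rangeI sum.empty to_fract_0)

lemma egf_upto_add: "egf_upto n f \<Longrightarrow> egf_upto n g \<Longrightarrow> egf_upto n (f + g)"
  by (auto simp: egf_upto_def distrib_left intro!: range_to_fract_add)

lemma egf_upto_const: "c \<in> range to_fract \<Longrightarrow> egf_upto n (fps_const c)"
proof -
  assume c: "c \<in> range to_fract"
  have "(0::'a fract) \<in> range to_fract" by (metis rangeI to_fract_0)
  with c show ?thesis
    by (auto simp: egf_upto_def)
qed

lemma egf_upto_mult:
  assumes "egf_upto n f" "egf_upto n g"
  shows "egf_upto n (f * g)"
  unfolding egf_upto_def
proof (intro allI impI)
  fix i assume i: "i \<le> n"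
  have "fact i * fps_nth (f * g) i
      = (\<Sum>j=0..i. of_nat (i choose j) *
          ((fact j * fps_nth f j) * (fact (i - j) * fps_nth g (i - j))))"
    unfolding fps_mult_nth sum_distrib_left
  proof (rule sum.cong)
    fix j assume "j \<in> {0..i}"
    then have "(fact i :: 'a fract) = fact j * fact (i - j) * of_nat (i choose j)"
      by (metis atLeastAtMost_iff binomial_fact_lemma of_nat_fact of_nat_mult)
    then show "fact i * (fps_nth f j * fps_nth g (i - j)) = of_nat (i choose j) *
          ((fact j * fps_nth f j) * (fact (i - j) * fps_nth g (i - j)))"
      by simp
  qed simp
  also have "\<dots> \<in> range to_fract"
  proof (rule range_to_fract_sum)
    fix j assume "j \<in> {0..i}"
    then have "fact j * fps_nth f j \<in> range to_fract"
        and "fact (i - j) * fps_nth g (i - j) \<in> range to_fract"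
      using assms i unfolding egf_upto_def by auto
    then show "of_nat (i choose j) * ((fact j * fps_nth f j) *
        (fact (i - j) * fps_nth g (i - j))) \<in> range to_fract"
      by (metis range_to_fract_mult range_to_fract_of_nat)
  qed
  finally show "fact i * fps_nth (f * g) i \<in> range to_fract" .
qed

lemma egf_upto_Suc:
  assumes "egf_upto n (fps_deriv f)" "fps_nth f 0 \<in> range to_fract"
  shows "egf_upto (Suc n) f"
  unfolding egf_upto_def
proof (intro allI impI)
  fix i assume "i \<le> Suc n"
  then show "fact i * fps_nth f i \<in> range to_fract"
    using assms unfolding egf_upto_def
    by (cases i) (auto simp: mult_ac)
qed

lemma fps_deriv_fps_powr:
  fixes u :: "'a::field_char_0 fps"
  assumes "fps_nth u 0 = 1"
  shows "u * fps_deriv (fps_powr u a) = fps_const a * fps_deriv u * fps_powr u a"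
proof -
  have u0: "fps_nth (u - 1) 0 = 0" using assms by simp
  have L0: "fps_nth (fps_ln 1 oo (u - 1)) 0 = 0" by simp
  have "inverse (1 + fps_X) oo (u - 1) = inverse u"
    using u0 by (simp add: fps_inverse_compose fps_compose_add_distrib)
  then have "fps_deriv (fps_ln 1 oo (u - 1)) = inverse u * fps_deriv u"
    by (simp add: fps_compose_deriv[OF u0] fps_ln_deriv)
  then have *: "fps_deriv (fps_powr u a) = fps_const a * fps_powr u a * (inverse u * fps_deriv u)"
    by (simp add: fps_powr_def fps_compose_deriv[OF L0] fps_compose_mult_distrib[OF L0])
  have "u * fps_deriv (fps_powr u a) = (u * inverse u) * (fps_const a * fps_deriv u * fps_powr u a)"
    by (simp only: * mult_ac)
  also have "u * inverse u = 1"
    using assms by (simp add: inverse_mult_eq_1')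
  finally show ?thesis by simp
qed

lemma to_fract_sv_poly: "to_fract (sv_poly n) = fact n * fps_nth (sv_egf var_x var_y) n"
proof -
  define x y where "x = var_x" and "y = var_y"
  define W where "W = fps_exp (x - 1) - fps_const x"
  define U where "U = fps_const (1 - x) / W"
  define G where "G = sv_egf x y"
  have "to_fract [:[:0, 1:]:] \<noteq> to_fract (1 :: rat poly poly)"
    unfolding to_fract_eq_iff by (simp add: one_pCons)
  then have x1: "x \<noteq> 1" by (simp add: x_def var_x_def)
  have W0: "fps_nth W 0 = 1 - x" by (simp add: W_def)
  have WU: "W * inverse W = 1"
    using x1 W0 by (simp add: inverse_mult_eq_1')
  have U: "U = fps_const (1 - x) * inverse W"
    using x1 W0 by (simp add: U_def fps_divide_unit)
  have U0: "fps_nth U 0 = 1" using x1 W0 by (simp add: U)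
  have W': "fps_deriv W = fps_const (x - 1) * (W + fps_const x)"
    by (simp add: W_def)
  have alg: "a * (- (- a * (w + b)) * v ^ 2) = (a * v) * (a * (w * v) + b * (a * v))"
    for a b v w :: "ratfun fps"
    by (simp add: power2_eq_square algebra_simps)
  have c: "fps_const (x - 1) = - fps_const (1 - x)" by simp
  have "fps_deriv U = fps_const (1 - x) * (- fps_deriv W * inverse W ^ 2)"
    using x1 W0 by (simp add: U fps_inverse_deriv)
  also have "\<dots> = (fps_const (1 - x) * inverse W) *
      (fps_const (1 - x) * (W * inverse W) + fps_const x * (fps_const (1 - x) * inverse W))"
    unfolding W' c by (rule alg)
  finally have U': "fps_deriv U = U * (fps_const (1 - x) + fps_const x * U)"
    by (simp add: WU U)
  have "U * fps_deriv G = U * (fps_const y * (fps_const (1 - x) + fps_const x * U) * G)"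
    using fps_deriv_fps_powr[OF U0, of y]
    by (simp add: G_def sv_egf_def U_def[symmetric] W_def[symmetric] U' mult_ac)
  moreover have "U \<noteq> 0" using U0 by auto
  ultimately have G': "fps_deriv G = fps_const y * (fps_const (1 - x) + fps_const x * U) * G"
    by simp
  have G0: "fps_nth G 0 = 1" by (simp add: G_def sv_egf_def fps_powr_def)
  have rx: "x \<in> range to_fract" "y \<in> range to_fract"
    by (auto simp: x_def y_def var_x_def var_y_def)
  have r1: "(1::ratfun) \<in> range to_fract" by (metis rangeI to_fract_1)
  have r1x: "1 - x \<in> range to_fract"
    by (metis rangeI to_fract_1 to_fract_diff var_x_def x_def)
  have PU: "egf_upto n U" for n
  proof (induction n)
    case 0
    then show ?case using U0 r1 by (simp add: egf_upto_def)
  next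
    case (Suc n)
    show ?case
      by (intro egf_upto_Suc)
         (simp_all add: U' U0 r1 del: fps_const_sub,
          intro egf_upto_mult egf_upto_add egf_upto_const Suc.IH rx r1x)
  qed
  have "egf_upto n G"
  proof (induction n)
    case 0
    then show ?case using G0 r1 by (simp add: egf_upto_def)
  next
    case (Suc n)
    show ?case
    proof (rule egf_upto_Suc)
      show "egf_upto n (fps_deriv G)" unfolding G'
        by (intro egf_upto_mult egf_upto_add egf_upto_const Suc.IH PU rx r1x)
    qed (use G0 r1 in simp)
  qed
  then obtain p where "to_fract p = fact n * fps_nth (sv_egf var_x var_y) n"
    unfolding egf_upto_def G_def x_def y_def by (metis imageE order_refl)
  then show ?thesis
    unfolding sv_poly_def by (metis (mono_tags, lifting) theI to_fract_eq_iff)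
qed

end

theory Submission
  imports Defs
begin

text \<open>
  Let \<open>U = (1 - x) / (e\<^bsup>t(x - 1)\<^esup> - x)\<close>, \<open>G = U\<^sup>y\<close> and \<open>V = U - 1\<close>. Then
  \<open>V' = (1 + V) (1 + x V)\<close> and \<open>G' = y (1 + x V) G\<close>, so the derivative of
  \<open>G V\<^sup>k / k!\<close> is a linear combination of its neighbours in k. The formal Laplace
  transform, whose value at \<open>G V\<^sup>k / k!\<close> is \<open>z\<^sup>k M\<^sub>k\<close>, turns this into the three-term
  recurrence of the J-fraction for \<open>M\<^sub>k\<close>. Interleaving the \<open>M\<^sub>k\<close> with the series
  \<open>M\<^bsub>k-1\<^esub> + k x z M\<^sub>k\<close> solves the recurrence of the S-fraction.
\<close>

lemma fps_X_dvd_iff: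
  fixes f :: "'a::comm_ring_1 fps"
  shows "fps_X dvd f \<longleftrightarrow> fps_nth f 0 = 0"
proof
  assume "fps_nth f 0 = 0"
  then have "f = fps_X * fps_shift 1 f"
    by (intro fps_ext) simp
  then show "fps_X dvd f" by (metis dvd_triv_left)
qed (auto simp: dvd_def)

section \<open>Convergence of continued fractions\<close>

text \<open>Every tail is divisible by its own leading numerator, which has zero constant term. Each
  denominator \<open>b 0 - t\<close> therefore keeps the constant term of \<open>b 0\<close> and is
  a unit.\<close>

lemma dvd_cfrac_trunc:
  fixes a b :: "nat \<Rightarrow> 'a::field fps"
  assumes "\<And>i. fps_nth (a (Suc i)) 0 = 0" "\<And>i. fps_nth (b i) 0 \<noteq> 0"
  shows "a 0 dvd cfrac_trunc a b n"
  using assms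
proof (induction n arbitrary: a b)
  case (Suc n)
  define t where "t = cfrac_trunc (\<lambda>i. a (Suc i)) (\<lambda>i. b (Suc i)) n"
  have "a (Suc 0) dvd t"
    unfolding t_def by (rule Suc.IH) (use Suc.prems in auto)
  then have "fps_nth (b 0 - t) 0 \<noteq> 0"
    using Suc.prems by (auto simp: dvd_def)
  then show ?case by (simp add: t_def fps_divide_unit)
qed simp

lemma cfrac_trunc_Suc_mult:
  fixes a b :: "nat \<Rightarrow> 'a::field fps"
  assumes "\<And>i. fps_nth (a (Suc i)) 0 = 0" "\<And>i. fps_nth (b i) 0 \<noteq> 0"
  shows "cfrac_trunc a b (Suc n) *
    (b 0 - cfrac_trunc (\<lambda>i. a (Suc i)) (\<lambda>i. b (Suc i)) n) = a 0"
proof -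
  define t where "t = cfrac_trunc (\<lambda>i. a (Suc i)) (\<lambda>i. b (Suc i)) n"
  have "a (Suc 0) dvd t"
    unfolding t_def by (rule dvd_cfrac_trunc) (use assms in auto)
  then have "fps_nth (b 0 - t) 0 \<noteq> 0"
    using assms by (auto simp: dvd_def)
  then have "is_unit (b 0 - t)" by simp
  then show ?thesis by (simp add: t_def)
qed

text \<open>Formally \<open>Q i / Q (Suc i)\<close> unfolds into the continued fraction, whose value
  is thus \<open>a 0 * Q 1 / Q 0\<close>; the cross-multiplied form avoids dividing by
  \<open>Q\<close>. Each level gains a factor \<open>fps_X\<close>: the factor \<open>a 0\<close> in
  the modulus becomes \<open>a (Suc 0)\<close> one level deeper.\<close>

lemma dvd_cfrac_trunc_error:
  fixes a b Q :: "nat \<Rightarrow> 'a::field fps"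
  assumes "\<And>i. fps_nth (a (Suc i)) 0 = 0" "\<And>i. fps_nth (b i) 0 \<noteq> 0"
    and "\<And>i. Q i = b i * Q (Suc i) - a (Suc i) * Q (Suc (Suc i))"
  shows "fps_X ^ n * a 0 dvd Q 0 * cfrac_trunc a b n - a 0 * Q 1"
  using assms
proof (induction n arbitrary: a b Q)
  case 0
  show ?case by simp
next
  case (Suc n)
  define T where "T = cfrac_trunc a b (Suc n)"
  define t where "t = cfrac_trunc (\<lambda>i. a (Suc i)) (\<lambda>i. b (Suc i)) n"
  have "fps_X ^ n * a (Suc 0) dvd Q (Suc 0) * t - a (Suc 0) * Q (Suc 1)"
    unfolding t_def by (rule Suc.IH; rule Suc.prems)
  moreover have "fps_X dvd a (Suc 0)"
    using Suc.prems(1)[of 0] by (simp add: fps_X_dvd_iff)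
  ultimately have "fps_X ^ n * fps_X dvd Q (Suc 0) * t - a (Suc 0) * Q (Suc 1)"
    by (meson dvd_trans mult_dvd_mono dvd_refl)
  moreover have "a 0 dvd T"
    unfolding T_def by (rule dvd_cfrac_trunc; rule Suc.prems)
  ultimately have *: "fps_X ^ n * fps_X * a 0 dvd (Q (Suc 0) * t - a (Suc 0) * Q (Suc 1)) * T"
    by (rule mult_dvd_mono)
  have a0: "a 0 = T * (b 0 - t)"
    unfolding T_def t_def by (rule cfrac_trunc_Suc_mult[symmetric]; rule Suc.prems)
  \<comment> \<open>The error of \<open>T\<close> is that of its tail \<open>t\<close> times
    \<open>T\<close>, and \<open>T\<close> contributes the divisor \<open>a 0\<close>.\<close>
  have **: "Q 0 * T - a 0 * Q 1 = (Q (Suc 0) * t - a (Suc 0) * Q (Suc 1)) * T"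
    unfolding a0 Suc.prems(3)[of 0] by (simp add: algebra_simps)
  show ?case
    using *[folded **] unfolding T_def power_Suc2 .
qed

text \<open>With \<open>a 0 = Q 0 = 1\<close> the error bound says that the n-th truncation agrees
  with \<open>Q 1\<close> modulo \<open>fps_X ^ n\<close>, so every coefficient stabilizes.\<close>

lemma has_cfracI:
  fixes a b Q :: "nat \<Rightarrow> 'a::field fps"
  assumes "\<And>i. fps_nth (a (Suc i)) 0 = 0" "\<And>i. fps_nth (b i) 0 \<noteq> 0"
    and "\<And>i. Q i = b i * Q (Suc i) - a (Suc i) * Q (Suc (Suc i))"
    and "a 0 = 1" "Q 0 = 1"
  shows "has_cfrac (Q 1) a b"
  unfolding has_cfrac_def tendsto_fps_iff
proof
  fix m
  have "fps_nth (cfrac_trunc a b n) m = fps_nth (Q 1) m" if "n > m" for n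
  proof -
    have "fps_X ^ n dvd cfrac_trunc a b n - Q 1"
      using dvd_cfrac_trunc_error[of a b Q n, OF assms(1-3)] assms(4,5) by simp
    then obtain h where "cfrac_trunc a b n - Q 1 = fps_X ^ n * h" ..
    then have "fps_nth (cfrac_trunc a b n - Q 1) m = 0"
      using that by (simp add: fps_X_power_mult_nth)
    then show ?thesis by simp
  qed
  then show "\<forall>\<^sub>F n in sequentially. fps_nth (cfrac_trunc a b n) m = fps_nth (Q 1) m"
    using eventually_gt_at_top by (rule eventually_mono[rotated])
qed

section \<open>The formal Laplace transform\<close>

definition fps_laplace :: "'a::field_char_0 fps \<Rightarrow> 'a fps" where
  "fps_laplace f = Abs_fps (\<lambda>n. fact n * fps_nth f n)"

lemma fps_laplace_nth [simp]: "fps_nth (fps_laplace f) n = fact n * fps_nth f n"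
  by (simp add: fps_laplace_def)

text \<open>Formal integration by parts: it converts differential equations into algebraic relations
  with a factor \<open>fps_X\<close>.\<close>

lemma fps_laplace_deriv:
  "fps_laplace f = fps_const (fps_nth f 0) + fps_X * fps_laplace (fps_deriv f)"
proof (rule fps_ext)
  fix n
  show "fps_nth (fps_laplace f) n =
      fps_nth (fps_const (fps_nth f 0) + fps_X * fps_laplace (fps_deriv f)) n"
    by (cases n) (simp_all add: mult_ac)
qed

lemma fps_laplace_add: "fps_laplace (f + g) = fps_laplace f + fps_laplace g"
  by (rule fps_ext) (simp add: algebra_simps)

lemma fps_laplace_const_mult: "fps_laplace (fps_const c * f) = fps_const c * fps_laplace f"
  by (rule fps_ext) (simp add: algebra_simps)

lemma X_power_dvd_fps_laplace:
  assumes "fps_X ^ k dvd f"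
  shows "fps_X ^ k dvd fps_laplace f"
proof -
  obtain h where h: "f = fps_X ^ k * h" using assms ..
  have "fps_laplace f = fps_X ^ k * fps_shift k (fps_laplace f)"
    by (rule fps_ext) (simp add: h fps_X_power_mult_nth)
  then show ?thesis by (metis dvd_triv_left)
qed

section \<open>Sheffer sequences of Meixner type\<close>

text \<open>Since \<open>V'\<close> is quadratic in \<open>V\<close> and \<open>G' / G\<close> is
  affine in \<open>V\<close>, only three consecutive powers occur; collect them from (1 + V)(1 + xV)
  = 1 + (1 + x)V + xV^2.\<close>

lemma meixner_derivative:
  fixes G V :: "'a::field_char_0 fps"
  assumes V': "fps_deriv V = (1 + V) * (1 + fps_const x * V)"
    and G': "fps_deriv G = fps_const y * (1 + fps_const x * V) * G"
  shows "fps_deriv (G * V ^ Suc k) = fps_const (of_nat (Suc k)) * (G * V ^ k)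
    + fps_const (of_nat (Suc k) * x + y + of_nat (Suc k)) * (G * V ^ Suc k)
    + fps_const (x * (y + of_nat (Suc k))) * (G * V ^ Suc (Suc k))"
proof -
  have "fps_deriv (G * V ^ Suc k) =
      fps_const (of_nat (Suc k)) * (G * V ^ k * ((1 + V) * (1 + fps_const x * V)))
      + fps_const y * (1 + fps_const x * V) * G * V ^ Suc k"
    by (simp add: fps_deriv_power V' G' mult_ac del: power_Suc of_nat_Suc)
  then show ?thesis
    by (simp add: algebra_simps fps_const_add[symmetric] fps_const_mult[symmetric]
        del: fps_const_add fps_const_mult of_nat_Suc)
qed

lemma meixner_recurrence:
  fixes G V :: "'a::field_char_0 fps"
  assumes V': "fps_deriv V = (1 + V) * (1 + fps_const x * V)" and V0: "fps_nth V 0 = 0"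
    and G': "fps_deriv G = fps_const y * (1 + fps_const x * V) * G" and G0: "fps_nth G 0 = 1"
  obtains M where "M 0 = fps_laplace G"
    and "1 = (1 - fps_const y * fps_X) * M 0 - fps_const (x * y) * fps_X ^ 2 * M (Suc 0)"
    and "\<And>k. M k =
      (1 - fps_const (of_nat (Suc k) * x + y + of_nat (Suc k)) * fps_X) * M (Suc k)
      - fps_const (of_nat (Suc (Suc k)) * x * (y + of_nat (Suc k))) * fps_X ^ 2
        * M (Suc (Suc k))"
proof -
  \<comment> \<open>Dividing by k! moves the factor k + 1 from the lower neighbour to the upper one,
    where k + 1 becomes k + 2: \<open>M k\<close> gets coefficient 1 and the upper term gets \<beta>
    at index k + 2.\<close>
  define L where "L k = fps_const (1 / fact k) * fps_laplace (G * V ^ k)" for k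
  have "fps_X dvd V" using V0 by (simp add: fps_X_dvd_iff)
  then have "fps_X ^ k dvd G * V ^ k" for k
    by (metis dvd_mult dvd_power_same)
  then have "fps_X ^ k dvd L k" for k
    unfolding L_def by (metis dvd_mult X_power_dvd_fps_laplace)
  \<comment> \<open>As \<open>V\<close> has zero constant term, \<open>L k\<close> has order at
    least k, so \<open>fps_X ^ k\<close> can be split off.\<close>
  then obtain M where M: "\<And>k. L k = fps_X ^ k * M k"
    unfolding dvd_def by metis
  have L0: "L 0 = 1 + fps_X * (fps_const y * L 0 + fps_const (x * y) * L (Suc 0))"
  proof -
    have "fps_deriv G = fps_const y * G + fps_const (x * y) * (G * V)"
      by (simp add: G' algebra_simps fps_const_mult[symmetric] del: fps_const_mult)
    then show ?thesis
      using fps_laplace_deriv[of G]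
      by (simp add: L_def G0 fps_laplace_add fps_laplace_const_mult)
  qed
  have LS: "L (Suc k) = fps_X * (L k
      + fps_const (of_nat (Suc k) * x + y + of_nat (Suc k)) * L (Suc k)
      + fps_const (of_nat (Suc (Suc k)) * x * (y + of_nat (Suc k))) * L (Suc (Suc k)))" for k
  proof -
    have alg: "r * (z * (p * f + a * g + q * h)) = z * (r * (p * f) + a * (r * g) + r * (q * h))"
      for a f g h p q r z :: "'a fps"
      by (simp add: algebra_simps)
    have "fps_nth (G * V ^ Suc k) 0 = 0" by (simp add: V0)
    then have "L (Suc k) = fps_const (1 / fact (Suc k)) *
        (fps_X * fps_laplace (fps_deriv (G * V ^ Suc k)))"
      unfolding L_def by (subst fps_laplace_deriv) simp
    moreover have "fps_const (1 / fact (Suc k)) * (fps_const (of_nat (Suc k)) * h)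
        = fps_const (1 / fact k) * h" for h :: "'a fps"
      unfolding mult.assoc[symmetric] fps_const_mult
      by (simp add: field_simps del: of_nat_Suc)
    moreover have "fps_const (1 / fact (Suc k)) * (fps_const (x * (y + of_nat (Suc k))) * h)
        = fps_const (of_nat (Suc (Suc k)) * x * (y + of_nat (Suc k)))
          * (fps_const (1 / fact (Suc (Suc k))) * h)" for h :: "'a fps"
    proof -
      have "(1 / fact (Suc k) :: 'a) = of_nat (Suc (Suc k)) * (1 / fact (Suc (Suc k)))"
        by (subst fact_Suc[of "Suc k"]) (simp del: of_nat_Suc fact_Suc)
      then show ?thesis
        unfolding mult.assoc[symmetric] fps_const_mult by (simp only: mult_ac)
    qed
    ultimately show ?thesis
      unfolding meixner_derivative[OF V' G'] fps_laplace_add fps_laplace_const_mult L_def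
      by (simp only: alg)
  qed
  show ?thesis
  proof
    show "M 0 = fps_laplace G" using M[of 0] by (simp add: L_def)
    show "1 = (1 - fps_const y * fps_X) * M 0 - fps_const (x * y) * fps_X ^ 2 * M (Suc 0)"
      using L0 by (simp add: M algebra_simps power2_eq_square)
    fix k
    define A where "A = fps_const (of_nat (Suc k) * x + y + of_nat (Suc k))"
    define B where "B = fps_const (of_nat (Suc (Suc k)) * x * (y + of_nat (Suc k)))"
    have "fps_X ^ Suc k * M (Suc k) =
        fps_X ^ Suc k * (M k + A * fps_X * M (Suc k) + B * fps_X ^ 2 * M (Suc (Suc k)))"
      using LS[of k] unfolding M A_def[symmetric] B_def[symmetric]
      by (simp add: algebra_simps power2_eq_square)
    then have "M (Suc k) = M k + A * fps_X * M (Suc k) + B * fps_X ^ 2 * M (Suc (Suc k))"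
      by (subst (asm) mult_left_cancel) auto
    then show "M k = (1 - fps_const (of_nat (Suc k) * x + y + of_nat (Suc k)) * fps_X) * M (Suc k)
      - fps_const (of_nat (Suc (Suc k)) * x * (y + of_nat (Suc k))) * fps_X ^ 2
        * M (Suc (Suc k))"
      unfolding A_def[symmetric] B_def[symmetric] by (simp add: algebra_simps)
  qed
qed

section \<open>The Savage-Viswanathan generating function\<close>

text \<open>The witness is V = U - 1 for the base U of the power; x \<noteq> 1 makes its denominator
  W invertible. Differentiating UW = 1 - x gives a Riccati equation for U.\<close>

lemma sv_egf_meixner:
  fixes x y :: "'a::field_char_0"
  assumes "x \<noteq> 1"
  obtains V where "fps_deriv V = (1 + V) * (1 + fps_const x * V)" "fps_nth V 0 = 0"
    and "fps_deriv (sv_egf x y) = fps_const y * (1 + fps_const x * V) * sv_egf x y"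
    and "fps_nth (sv_egf x y) 0 = 1"
proof
  define W where "W = fps_exp (x - 1) - fps_const x"
  define U where "U = fps_const (1 - x) / W"
  have W0: "fps_nth W 0 \<noteq> 0" using assms by (simp add: W_def)
  then have UW: "U * W = fps_const (1 - x)"
    by (simp add: U_def)
  have U0: "fps_nth U 0 = 1"
    using arg_cong[OF UW, of "\<lambda>f. fps_nth f 0"] assms by (simp add: W_def)
  have "fps_deriv U * W + U * fps_deriv W = 0"
    using arg_cong[OF UW, of fps_deriv] by (simp add: add.commute)
  moreover have "fps_deriv W = - fps_const (1 - x) * (W + fps_const x)"
    by (simp add: W_def)
  \<comment> \<open>The constant 1 - x from \<open>W'\<close> is traded for UW, so that W can be
    cancelled later.\<close>
  ultimately have "fps_deriv U * W = U * (U * W) * (W + fps_const x)"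
    unfolding UW by (simp add: algebra_simps del: fps_const_sub fps_const_neg)
  then have "fps_deriv U * W = U * (fps_const (1 - x) + fps_const x * U) * W"
    unfolding UW[symmetric] by (simp add: algebra_simps)
  moreover have "W \<noteq> 0" using W0 by auto
  ultimately have U': "fps_deriv U = U * (fps_const (1 - x) + fps_const x * U)"
    by simp
  have c: "1 + fps_const x * (U - 1) = fps_const (1 - x) + fps_const x * U"
    by (simp add: algebra_simps fps_const_sub[symmetric] del: fps_const_sub)
  show "fps_deriv (U - 1) = (1 + (U - 1)) * (1 + fps_const x * (U - 1))"
    unfolding c by (simp add: U')
  show "fps_nth (U - 1) 0 = 0" using U0 by simp
  have "U * fps_deriv (sv_egf x y) =
      U * (fps_const y * (fps_const (1 - x) + fps_const x * U) * sv_egf x y)"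
    using fps_deriv_fps_powr[OF U0, of y]
    by (simp add: sv_egf_def U_def[symmetric] W_def[symmetric] U' mult_ac)
  moreover have "U \<noteq> 0" using U0 by auto
  ultimately show "fps_deriv (sv_egf x y) =
      fps_const y * (1 + fps_const x * (U - 1)) * sv_egf x y"
    unfolding c by simp
  show "fps_nth (sv_egf x y) 0 = 1" by (simp add: sv_egf_def fps_powr_def)
qed

theorem corollary7:
  fixes x y :: ratfun and c \<alpha> \<beta> :: "nat \<Rightarrow> ratfun"
  assumes "x = var_x" and "y = var_y"
    and "\<And>i. i \<ge> 1 \<Longrightarrow> c (2 * i - 1) = y + of_nat i - 1"
    and "\<And>i. i \<ge> 1 \<Longrightarrow> c (2 * i) = of_nat i * x"
    and "\<And>i. \<alpha> i = of_nat i * x + y + of_nat i"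
    and "\<And>i. i \<ge> 1 \<Longrightarrow> \<beta> i = of_nat i * x * (y + of_nat i - 1)"
  shows "has_cfrac (Abs_fps (\<lambda>n. to_fract (sv_poly n)))
           (\<lambda>k. if k = 0 then 1 else fps_const (c k) * fps_X)
           (\<lambda>k. 1)
       \<and> has_cfrac (Abs_fps (\<lambda>n. to_fract (sv_poly n)))
           (\<lambda>k. if k = 0 then 1 else fps_const (\<beta> k) * fps_X ^ 2)
           (\<lambda>k. 1 - fps_const (\<alpha> k) * fps_X)"
proof -
  have "to_fract [:[:0, 1:]:] \<noteq> to_fract (1 :: rat poly poly)"
    unfolding to_fract_eq_iff by (simp add: one_pCons)
  then have "x \<noteq> 1" by (simp add: assms(1) var_x_def)
  then obtain M where M: "M 0 = fps_laplace (sv_egf x y)"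
    and M0: "1 = (1 - fps_const y * fps_X) * M 0 - fps_const (x * y) * fps_X ^ 2 * M (Suc 0)"
    and MS: "\<And>k. M k =
      (1 - fps_const (of_nat (Suc k) * x + y + of_nat (Suc k)) * fps_X) * M (Suc k)
      - fps_const (of_nat (Suc (Suc k)) * x * (y + of_nat (Suc k))) * fps_X ^ 2
        * M (Suc (Suc k))"
    using sv_egf_meixner meixner_recurrence by metis
  have F: "Abs_fps (\<lambda>n. to_fract (sv_poly n)) = M 0"
    by (rule fps_ext) (simp add: M to_fract_sv_poly assms(1,2))
  have \<alpha>: "\<alpha> i = of_nat i * x + y + of_nat i" for i by fact
  have \<beta>: "\<beta> (Suc i) = of_nat (Suc i) * x * (y + of_nat i)" for i
    using assms(6)[of "Suc i"] by simp
  have c_odd: "c (Suc (2 * i)) = y + of_nat i" for i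
    using assms(3)[of "Suc i"] by simp
  have c_even: "c (Suc (Suc (2 * i))) = of_nat (Suc i) * x" for i
    using assms(4)[of "Suc i"] by simp
  \<comment> \<open>Prepending 1 merges the initial equation and the recurrence for \<open>M\<close>
    into one recurrence valid from index 0.\<close>
  define P where "P = case_nat 1 M"
  have P: "P k = (1 - fps_const (\<alpha> k) * fps_X) * P (Suc k)
      - fps_const (\<beta> (Suc k)) * fps_X ^ 2 * P (Suc (Suc k))" for k
  proof (cases k)
    case 0
    then show ?thesis using M0 \<alpha>[of 0] \<beta>[of 0] by (simp add: P_def)
  next
    case (Suc j)
    then show ?thesis using MS[of j] by (simp only: \<alpha> \<beta> P_def nat.case)
  qed
  have J: "has_cfrac (P 1) (\<lambda>k. if k = 0 then 1 else fps_const (\<beta> k) * fps_X ^ 2)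
      (\<lambda>k. 1 - fps_const (\<alpha> k) * fps_X)"
  proof (rule has_cfracI[where Q = P])
    fix i
    show "P i = (1 - fps_const (\<alpha> i) * fps_X) * P (Suc i)
        - (if Suc i = 0 then 1 else fps_const (\<beta> (Suc i)) * fps_X ^ 2) * P (Suc (Suc i))"
      using P[of i] by simp
  qed (simp_all add: P_def)
  \<comment> \<open>The odd entries are the \<open>M\<close> series. The even ones are chosen so
    that the S-recurrence at odd n is an identity; at n = 0 the correction vanishes and
    \<open>Q 0 = 1\<close>.\<close>
  define Q where "Q n = (if odd n then P (Suc (n div 2))
    else P (n div 2) + fps_const (of_nat (n div 2) * x) * fps_X * P (Suc (n div 2)))" for n
  have Q: "Q n = 1 * Q (Suc n) - fps_const (c (Suc n)) * fps_X * Q (Suc (Suc n))" for n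
  proof (cases "even n")
    case True
    then obtain i where n: "n = 2 * i" ..
    define A B where "A = fps_const (y + of_nat i)" and "B j = fps_const (of_nat j * x)" for j
    \<comment> \<open>This is the contraction from S- to J-fraction: \<beta>_{i+1} = c_{2i+1}
      c_{2i+2} and \<alpha>_i = c_{2i} + c_{2i+1}, with 0 in place of c_0. Hence the recurrence of
      \<open>P\<close> yields the S-recurrence at even n.\<close>
    have "fps_const (\<beta> (Suc i)) = B (Suc i) * A" "fps_const (\<alpha> i) = B i + A"
      by (simp_all add: \<alpha> \<beta> A_def B_def add_ac)
    then have "P i = (1 - (B i + A) * fps_X) * P (Suc i)
        - B (Suc i) * A * fps_X ^ 2 * P (Suc (Suc i))"
      using P[of i] by simp
    then have "P i + B i * fps_X * P (Suc i) =
        P (Suc i) - A * fps_X * (P (Suc i) + B (Suc i) * fps_X * P (Suc (Suc i)))"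
      by (simp add: algebra_simps power2_eq_square)
    then show ?thesis
      by (simp add: Q_def n c_odd A_def B_def del: of_nat_Suc)
  next
    case False
    then obtain i where n: "n = Suc (2 * i)" by (auto elim: oddE)
    show ?thesis by (simp add: Q_def n c_even del: of_nat_Suc)
  qed
  have S: "has_cfrac (Q 1) (\<lambda>k. if k = 0 then 1 else fps_const (c k) * fps_X) (\<lambda>k. 1)"
  proof (rule has_cfracI[where Q = Q])
    fix i
    show "Q i = 1 * Q (Suc i)
        - (if Suc i = 0 then 1 else fps_const (c (Suc i)) * fps_X) * Q (Suc (Suc i))"
      using Q[of i] by simp
  qed (simp_all add: Q_def P_def)
  show ?thesis using J S unfolding F by (simp add: Q_def P_def)
qed

end
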